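(* Let the parameters of the ADOM iteration be set to $$\alpha = \frac{1}{2L},\quad \eta = \frac{2\lambda_{\min}^+\sqrt{\mu L}}{7\lambda_{\max}},\quad \theta = \frac{\mu}{\lambda_{\max}},\quad \sigma = \frac{1}{\lambda_{\max}},\quad \tau = \frac{\lambda_{\min}^+}{7\lambda_{\max}}\sqrt{\frac{\mu}{L}},$$ and let $z^0\in\mathcal{L}^\perp$, $m^0\in(\mathbb{R}^d)^{\mathcal{V}}$. Then there exists a constant $C>0$ (independent of $k$) such that for all $k\in\{0,1,2,\ldots\}$ $$\|\nabla F^*(z_g^k) - x^*\|^2 \leq C\left(1-\frac{\lambda_{\min}^+}{7\lambda_{\max}}\sqrt{\frac{\mu}{L}}\right)^k .$$
   Context: **Functions.** Let $\mathcal{V}=\{1,\ldots,n\}$ and let $f_i:\mathbb{R}^d\to\mathbb{R}$, $i\in\mathcal{V}$, be differentiable, $L$-smooth and $\mu$-strongly convex ($0<\mu\le L$): for all $x,y\in\mathbb{R}^d$, $f_i(y)+\langle\nabla f_i(y),x-y\rangle+\frac{\mu}{2}\|x-y\|^2\le f_i(x)\le f_i(y)+\langle\nabla f_i(y),x-y\rangle+\frac{L}{2}\|x-y\|^2$. Define $F:(\mathbb{R}^d)^{\mathcal{V}}\to\mathbb{R}$ by $F(x)=\sum_{i\in\mathcal{V}}f_i(x_i)$ for $x=(x_1,\ldots,x_n)$, and let $F^*$ be its Fenchel conjugate, $F^*(z)=\sup_x\{\langle x,z\rangle-F(x)\}$ (which is $\frac1\mu$-smooth and $\frac1L$-strongly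 convex). Norms and inner products are Euclidean. **Spaces and solutions.** $\mathcal{L}=\{(x_1,\ldots,x_n)\in(\mathbb{R}^d)^{\mathcal{V}}:x_1=\cdots=x_n\}$, with orthogonal complement $\mathcal{L}^\perp=\{(z_1,\ldots,z_n)\in(\mathbb{R}^d)^{\mathcal{V}}:\sum_{i=1}^n z_i=0\}$. $x^*\in\mathcal{L}$ is the unique minimizer of $F$ over $\mathcal{L}$. $\mathbf{P}=(\mathbf{I}_n-\frac1n\mathbf{1}_n\mathbf{1}_n^\top)\otimes\mathbf{I}_d$ is the orthogonal projector onto $\mathcal{L}^\perp$. **Time-varying network.** For each $k\in\{0,1,2,\ldots\}$, $\mathcal{G}^k=(\mathcal{V},\mathcal{E}^k)$ is an undirected connected graph, and $\hat{\mathbf{W}}(k)\in\mathbb{R}^{n\times n}$ is a matrix such that: (1) it is symmetric positive semi-definite; (2) $\hat{\mathbf{W}}(k)_{i,j}\neq0$ if and only if $(i,j)\in\mathcal{E}^k$ or $i=j$; (3) $\ker\hat{\mathbf{W}}(k)=\{x\in\mathbb{R}^n:x_1=\cdots=x_n\}$. Put $\mathbf{W}(k)=\hat{\mathbf{W}}(k)\otimes\mathbf{I}_d$, acting on $(\mathbb{R}^d)^{\mathcal{V}}$. There are constants $0<\lambda_{\min}^+<\lambda_{\max}$ such that, for all $k$, the smallest positive eigenvalue of $\hat{\mathbf{W}}(k)$ is at least $\lambda_{\min}^+$ and its largest eigenvalue is at most $\lambda_{\max}$; equivalently, $\lambda_{\min}^+\mathbf{P}\preceq\mathbf{W}(k)\preceq\lambda_{\max}\mathbf{P}$.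 **ADOM iteration.** Input: $z^0\in\mathcal{L}^\perp$, $m^0\in(\mathbb{R}^d)^{\mathcal{V}}$, parameters $\alpha,\eta,\theta,\sigma>0$, $\tau\in(0,1)$. Set $z_f^0=z^0$ and for $k=0,1,2,\ldots$: - $z_g^k=\tau z^k+(1-\tau)z_f^k$, - $\Delta^k=\sigma\mathbf{W}(k)(m^k-\eta\nabla F^*(z_g^k))$, - $m^{k+1}=m^k-\eta\nabla F^*(z_g^k)-\Delta^k$, - $z^{k+1}=z^k+\eta\alpha(z_g^k-z^k)+\Delta^k$, - $z_f^{k+1}=z_g^k-\theta\mathbf{W}(k)\nabla F^*(z_g^k)$. *)

theory Defs
  imports "HOL-Analysis.Analysis"
begin

text \<open>The node set is a finite type \<open>'n\<close>, and \<open>(\<real>\<^sup>d)\<^sup>n\<close> is \<open>real ^ 'd ^ 'n\<close>, whose library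
  norm and inner product are the Euclidean ones.\<close>

text \<open>Meaningful only where \<open>f\<close> is differentiable; the gradient is then unique.\<close>

definition grad :: "('a::real_inner \<Rightarrow> real) \<Rightarrow> 'a \<Rightarrow> 'a" where
  "grad f x = (THE D. GDERIV f x :> D)"

definition smooth_strongly_convex :: "real \<Rightarrow> real \<Rightarrow> ('a::real_inner \<Rightarrow> real) \<Rightarrow> bool" where
  "smooth_strongly_convex L \<mu> f \<longleftrightarrow>
     (\<forall>x. f differentiable (at x)) \<and>
     (\<forall>x y. f y + grad f y \<bullet> (x - y) + \<mu> / 2 * (norm (x - y))\<^sup>2 \<le> f x \<and>
            f x \<le> f y + grad f y \<bullet> (x - y) + L / 2 * (norm (x - y))\<^sup>2)"

definition separable_sum :: "('n \<Rightarrow> 'a \<Rightarrow> real) \<Rightarrow> 'a ^ 'n \<Rightarrow> real" where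
  "separable_sum f x = (\<Sum>i\<in>UNIV. f i (x $ i))"

text \<open>The supremum is taken in \<open>real\<close>. For strongly convex \<open>F\<close> the set below is bounded above
  for every \<open>z\<close>, so this is the usual conjugate.\<close>

definition fenchel_conjugate :: "('a::real_inner \<Rightarrow> real) \<Rightarrow> 'a \<Rightarrow> real" where
  "fenchel_conjugate F z = (SUP x. x \<bullet> z - F x)"

definition consensus :: "('a ^ 'n) set" where
  "consensus = {x. \<forall>i j. x $ i = x $ j}"

definition eigenvalues :: "real ^ 'n ^ 'n \<Rightarrow> real set" where
  "eigenvalues A = {l. \<exists>v. v \<noteq> 0 \<and> A *v v = l *\<^sub>R v}"

definition undirected_connected :: "('n \<times> 'n) set \<Rightarrow> bool" where
  "undirected_connected E \<longleftrightarrow> sym E \<and> (\<forall>i j. (i, j) \<in> E\<^sup>*)"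

definition gossip_matrix :: "('n::finite \<times> 'n) set \<Rightarrow> real ^ 'n ^ 'n \<Rightarrow> bool" where
  "gossip_matrix E A \<longleftrightarrow>
     transpose A = A \<and> (\<forall>x. 0 \<le> x \<bullet> (A *v x)) \<and>
     (\<forall>i j. A $ i $ j \<noteq> 0 \<longleftrightarrow> (i, j) \<in> E \<or> i = j) \<and>
     {x. A *v x = 0} = consensus"

text \<open>For a gossip matrix both sets are finite and nonempty, so \<open>Min\<close> and \<open>Max\<close> are
  attained: it is symmetric, positive semidefinite and, having a nonzero diagonal, not zero.\<close>

definition spectral_bounds :: "real \<Rightarrow> real \<Rightarrow> real ^ 'n ^ 'n \<Rightarrow> bool" where
  "spectral_bounds lmin lmax A \<longleftrightarrow>
     lmin \<le> Min {l \<in> eigenvalues A. 0 < l} \<and> Max (eigenvalues A) \<le> lmax"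

text \<open>The action of the Kronecker product of \<open>A\<close> with the identity on blocks.\<close>

definition block_action :: "real ^ 'n ^ 'n \<Rightarrow> 'a::real_vector ^ 'n \<Rightarrow> 'a ^ 'n" where
  "block_action A x = (\<chi> i. \<Sum>j\<in>UNIV. A $ i $ j *\<^sub>R x $ j)"

text \<open>\<open>G\<close> stands for the gradient of the conjugate, and \<open>W k\<close> for the operator applied at
  step \<open>k\<close>. The equations determine all five sequences from \<open>z 0\<close> and \<open>m 0\<close>.\<close>

definition adom_iteration ::
  "('v::real_vector \<Rightarrow> 'v) \<Rightarrow> (nat \<Rightarrow> 'v \<Rightarrow> 'v) \<Rightarrow> real \<Rightarrow> real \<Rightarrow> real \<Rightarrow> real \<Rightarrow> real \<Rightarrow>
   (nat \<Rightarrow> 'v) \<Rightarrow> (nat \<Rightarrow> 'v) \<Rightarrow> (nat \<Rightarrow> 'v) \<Rightarrow> (nat \<Rightarrow> 'v) \<Rightarrow> (nat \<Rightarrow> 'v) \<Rightarrow> bool" where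
  "adom_iteration G W \<alpha> \<eta> \<theta> \<sigma> \<tau> z m zf zg \<Delta> \<longleftrightarrow>
     zf 0 = z 0 \<and>
     (\<forall>k. zg k = \<tau> *\<^sub>R z k + (1 - \<tau>) *\<^sub>R zf k \<and>
          \<Delta> k = \<sigma> *\<^sub>R W k (m k - \<eta> *\<^sub>R G (zg k)) \<and>
          m (Suc k) = m k - \<eta> *\<^sub>R G (zg k) - \<Delta> k \<and>
          z (Suc k) = z k + (\<eta> * \<alpha>) *\<^sub>R (zg k - z k) + \<Delta> k \<and>
          zf (Suc k) = zg k - \<theta> *\<^sub>R W k (G (zg k)))"

end

theory Submission
  imports Defs
begin

text \<open>ADOM is an accelerated gradient method for the dual problem of minimizing the conjugate \<open>H\<close> of
  \<open>F\<close> over the zero-sum vectors, the orthogonal complement of the consensus vectors. Conjugation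
  exchanges smoothness and strong convexity (\<open>smooth_strongly_convex_conjugate\<close>), so \<open>H\<close> is
  \<open>1 / \<mu>\<close>-smooth and \<open>1 / L\<close>-strongly convex, and the gradients of \<open>F\<close> and \<open>H\<close> are inverse to
  each other. With \<open>zs\<close> the gradient of \<open>F\<close> at the solution, which is the dual minimizer, the
  error to be estimated is therefore at most \<open>1 / \<mu>\<close> times the distance of \<open>zg\<close> to \<open>zs\<close>.

  An exact dual gradient step would need the projector \<open>P\<close> onto the zero-sum vectors; a node can
  apply only the gossip operators \<open>W k\<close>, which change in every round. Two properties of these,
  both consequences of the spectral bounds, replace exactness: the squared norm of \<open>W k x\<close> is at
  most \<open>lmax\<close> times \<open>x \<bullet> W k x\<close>, and \<open>W k\<close> is \<open>lmin\<close>-coercive on zero-sum vectors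
  (\<open>block_action_norm_le\<close>, \<open>block_action_coercive\<close>). They are used twice. In the update of \<open>zf\<close>
  they give a descent step for \<open>H\<close> proportional to the squared norm of the projected gradient
  (\<open>dual_descent\<close>). In the update of \<open>m\<close> they make the memory of untransmitted gradients contract
  (\<open>error_feedback_contraction\<close>). The sum \<open>z + P m\<close> then obeys an accelerated recursion with an
  error governed by \<open>P m\<close> (\<open>distance_recursion\<close>).

  The squared distance of \<open>z + P m\<close> to \<open>zs\<close>, the weighted gap of \<open>H\<close> at \<open>zf\<close> and \<open>6\<close> times the
  squared norm of \<open>P m\<close> add up to a function that shrinks by the factor \<open>1 - \<tau>\<close> in every step
  (\<open>lyapunov_contraction\<close>), and it bounds the squared distance of \<open>zg\<close> to \<open>zs\<close> up to a constant factor.\<close>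

section \<open>Smooth and strongly convex functions\<close>

text \<open>First-order optimality in disguise. It turns the minimality of a Rayleigh quotient into an
  eigenvector equation, and the minimality of a function on a subspace into orthogonality of
  its gradient.\<close>

lemma quadratic_nonneg_imp_linear_coeff_zero:
  fixes b c :: real
  assumes nonneg: "\<And>t. 0 \<le> b * t + c * t\<^sup>2"
  shows "b = 0"
proof -
  (* The test point t = - b / s makes the linear term win, since c < s. *)
  define s where "s = \<bar>c\<bar> + 1"
  have s: "0 < s" "c - s \<le> -1" by (auto simp: s_def)
  have "0 \<le> b * (- b / s) + c * (- b / s)\<^sup>2" by (rule nonneg)
  also have "\<dots> = b\<^sup>2 * (c - s) / s\<^sup>2"
    using s by (simp add: field_simps power2_eq_square)
  finally have "0 \<le> b\<^sup>2 * (c - s)" using s by (simp add: zero_le_divide_iff)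
  moreover have "b\<^sup>2 * (c - s) \<le> b\<^sup>2 * (-1)" by (intro mult_left_mono s) auto
  ultimately have "b\<^sup>2 \<le> 0" by linarith
  then show "b = 0" by simp
qed

text \<open>Two-sided quadratic bounds already force differentiability. So both for separable sums and for
  conjugates it is enough to guess the gradient and to prove the two inequalities.\<close>

lemma GDERIV_of_quadratic_bound:
  fixes f :: "'a::real_inner \<Rightarrow> real"
  assumes bound: "\<And>x. \<bar>f x - f y - D \<bullet> (x - y)\<bar> \<le> C * (norm (x - y))\<^sup>2"
  shows "GDERIV f y :> D"
proof -
  have "((\<lambda>h. norm (f (y + h) - f y - h \<bullet> D) / norm h) \<longlongrightarrow> 0) (at 0)"
  proof (rule Lim_null_comparison)
    show "\<forall>\<^sub>F h in at 0. norm (norm (f (y + h) - f y - h \<bullet> D) / norm h) \<le> C * norm h"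
      using bound[of "y + _"]
      by (intro always_eventually allI)
         (auto simp: divide_simps power2_eq_square inner_commute ac_simps)
    show "((\<lambda>h. C * norm h) \<longlongrightarrow> 0) (at (0::'a))"
      by (intro tendsto_eq_intros) auto
  qed
  then show ?thesis
    by (simp add: gderiv_def has_derivative_at bounded_linear_inner_left)
qed

lemma grad_eqI:
  assumes "GDERIV f y :> D"
  shows "grad f y = D"
  unfolding grad_def
proof (rule the_equality[where P = "\<lambda>D. GDERIV f y :> D", OF assms])
  fix D' assume "GDERIV f y :> D'"
  then have "(\<lambda>h. h \<bullet> D') = (\<lambda>h. h \<bullet> D)"
    using assms unfolding gderiv_def by (rule has_derivative_unique)
  then show "D' = D" by (metis inner_commute vector_eq_rdot)
qed

lemma smooth_strongly_convexI:
  fixes f :: "'a::real_inner \<Rightarrow> real"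
  assumes "0 \<le> \<mu>" "0 \<le> L"
    and lower: "\<And>x y. f y + D y \<bullet> (x - y) + \<mu> / 2 * (norm (x - y))\<^sup>2 \<le> f x"
    and upper: "\<And>x y. f x \<le> f y + D y \<bullet> (x - y) + L / 2 * (norm (x - y))\<^sup>2"
  shows "smooth_strongly_convex L \<mu> f" and "grad f = D"
proof -
  have der: "GDERIV f y :> D y" for y
  proof (rule GDERIV_of_quadratic_bound)
    fix x
    have "0 \<le> \<mu> / 2 * (norm (x - y))\<^sup>2" "0 \<le> L / 2 * (norm (x - y))\<^sup>2"
      using assms(1,2) by simp_all
    then show "\<bar>f x - f y - D y \<bullet> (x - y)\<bar> \<le> L / 2 * (norm (x - y))\<^sup>2"
      using lower[of y x] upper[of x y] by linarith
  qed
  show "grad f = D" by (rule ext, rule grad_eqI, rule der)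
  then show "smooth_strongly_convex L \<mu> f"
    using lower upper der
    unfolding smooth_strongly_convex_def gderiv_def differentiable_def by blast
qed

lemma smooth_strongly_convexD:
  assumes "smooth_strongly_convex L \<mu> f"
  shows "f y + grad f y \<bullet> (x - y) + \<mu> / 2 * (norm (x - y))\<^sup>2 \<le> f x"
    and "f x \<le> f y + grad f y \<bullet> (x - y) + L / 2 * (norm (x - y))\<^sup>2"
    and "f differentiable (at x)"
  using assms by (auto simp: smooth_strongly_convex_def)

text \<open>The offset \<open>t * b\<close> lets one statement serve two purposes: with \<open>b = z \<bullet> h\<close> it identifies the
  gradient at a minimizer of \<open>f x - x \<bullet> z\<close>, and with \<open>b = 0\<close> it gives orthogonality to a subspace
  of directions.\<close>

lemma first_order_optimality:
  assumes f: "smooth_strongly_convex L \<mu> f"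
    and opt: "\<And>t. f x \<le> f (x + t *\<^sub>R h) - t * b"
  shows "grad f x \<bullet> h = b"
proof -
  have "grad f x \<bullet> h - b = 0"
  proof (rule quadratic_nonneg_imp_linear_coeff_zero)
    fix t
    show "0 \<le> (grad f x \<bullet> h - b) * t + L / 2 * (norm h)\<^sup>2 * t\<^sup>2"
      using opt[of t] smooth_strongly_convexD(2)[OF f, of "x + t *\<^sub>R h" x]
      by (simp add: algebra_simps power_mult_distrib)
  qed
  then show ?thesis by simp
qed

lemma grad_strongly_monotone:
  assumes "smooth_strongly_convex L \<mu> f"
  shows "\<mu> * (norm (x - y))\<^sup>2 \<le> (grad f x - grad f y) \<bullet> (x - y)"
  using smooth_strongly_convexD(1)[OF assms, of y x] smooth_strongly_convexD(1)[OF assms, of x y]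
  by (simp add: inner_diff norm_minus_commute[of y x] algebra_simps)

lemma grad_expansive:
  assumes "smooth_strongly_convex L \<mu> f"
  shows "\<mu> * norm (x - y) \<le> norm (grad f x - grad f y)"
proof (cases "x = y")
  case False
  have "\<mu> * norm (x - y) * norm (x - y) \<le> norm (grad f x - grad f y) * norm (x - y)"
    using grad_strongly_monotone[OF assms, of x y]
      norm_cauchy_schwarz[of "grad f x - grad f y" "x - y"]
    by (simp add: power2_eq_square)
  then show ?thesis using False by simp
qed simp

text \<open>Strong convexity makes \<open>x \<bullet> z - f x\<close> smaller than its value at the origin outside a ball, so it
  attains its supremum, and there the gradient of \<open>f\<close> equals \<open>z\<close>.\<close>

lemma grad_surjective:
  fixes f :: "'a::euclidean_space \<Rightarrow> real"
  assumes f: "smooth_strongly_convex L \<mu> f" and "0 < \<mu>"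
  shows "\<exists>x. grad f x = z"
proof -
  define \<phi> where "\<phi> x = x \<bullet> z - f x" for x
  define c where "c = z - grad f 0"
  (* Strong convexity at 0 bounds \<phi> y by \<phi> 0 + norm y * (norm c - \<mu> / 2 * norm y);
     beyond the radius R the second factor is negative. *)
  define R where "R = 2 * norm c / \<mu>"
  have cont: "continuous_on UNIV \<phi>"
    unfolding \<phi>_def using smooth_strongly_convexD(3)[OF f]
    by (intro continuous_intros)
       (simp add: differentiable_imp_continuous_on differentiable_on_def differentiable_at_withinI)
  have "0 \<le> R" using \<open>0 < \<mu>\<close> by (simp add: R_def)
  then have "\<exists>x\<in>cball 0 R. \<forall>y\<in>cball 0 R. \<phi> y \<le> \<phi> x"
    using continuous_on_subset[OF cont] by (intro continuous_attains_sup) auto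
  then obtain x where x: "\<And>y. norm y \<le> R \<Longrightarrow> \<phi> y \<le> \<phi> x" by (metis mem_cball_0)
  have "\<phi> y \<le> \<phi> x" for y
  proof (cases "norm y \<le> R")
    case False
    have "\<phi> y \<le> - f 0 + c \<bullet> y - \<mu> / 2 * (norm y)\<^sup>2"
      using smooth_strongly_convexD(1)[OF f, of 0 y]
      by (simp add: \<phi>_def c_def inner_diff inner_commute)
    also have "\<dots> \<le> - f 0 + norm y * (norm c - \<mu> / 2 * norm y)"
      using norm_cauchy_schwarz[of c y] by (simp add: algebra_simps power2_eq_square)
    also have "\<dots> \<le> - f 0"
    proof -
      have "norm c - \<mu> / 2 * norm y \<le> 0"
        using False \<open>0 < \<mu>\<close> by (simp add: R_def field_simps)
      then show ?thesis by (simp add: mult_nonneg_nonpos)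
    qed
    also have "\<dots> \<le> \<phi> x" using x[of 0] \<open>0 < \<mu>\<close> by (simp add: R_def \<phi>_def)
    finally show ?thesis .
  qed (rule x)
  note max = this
  have "f x \<le> f (x + t *\<^sub>R h) - t * (z \<bullet> h)" for t h
  proof -
    have "\<phi> (x + t *\<^sub>R h) \<le> \<phi> x" by (rule max)
    then show ?thesis by (simp add: \<phi>_def inner_add_left inner_commute[of h z])
  qed
  then have "grad f x \<bullet> h = z \<bullet> h" for h by (rule first_order_optimality[OF f])
  then show ?thesis by (metis vector_eq_rdot)
qed

section \<open>The Fenchel conjugate\<close>

lemma fenchel_conjugate_attained:
  assumes f: "smooth_strongly_convex L \<mu> f" and "0 \<le> \<mu>"
  shows "fenchel_conjugate f (grad f x) = x \<bullet> grad f x - f x"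
  unfolding fenchel_conjugate_def
proof (rule cSup_eq_maximum)
  fix v assume "v \<in> range (\<lambda>y. y \<bullet> grad f x - f y)"
  then obtain y where v: "v = y \<bullet> grad f x - f y" by auto
  have "0 \<le> \<mu> / 2 * (norm (y - x))\<^sup>2" using \<open>0 \<le> \<mu>\<close> by simp
  then show "v \<le> x \<bullet> grad f x - f x"
    using smooth_strongly_convexD(1)[OF f, of x y] by (simp add: v inner_diff inner_commute)
qed auto

text \<open>Let \<open>G\<close> be the inverse of the gradient of \<open>f\<close> and \<open>z = grad f x\<close>. Conjugation reverses the
  quadratic bounds of \<open>f\<close> around \<open>x\<close>: the upper one, evaluated at its best point
  \<open>x + (w - z) / L\<close>, bounds the conjugate at \<open>w\<close> from below, and the lower one bounds it from
  above. As these are quadratic bounds with slope \<open>G\<close>, the gradient of the conjugate is \<open>G\<close>.\<close>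

lemma smooth_strongly_convex_conjugate:
  fixes f :: "'a::euclidean_space \<Rightarrow> real"
  assumes f: "smooth_strongly_convex L \<mu> f" and \<mu>: "0 < \<mu>" and L: "0 < L"
  shows "smooth_strongly_convex (1 / \<mu>) (1 / L) (fenchel_conjugate f)"
    and "grad (fenchel_conjugate f) (grad f x) = x"
proof -
  define H where "H = fenchel_conjugate f"
  have H: "H (grad f x) = x \<bullet> grad f x - f x" for x
    unfolding H_def using f \<mu> by (simp add: fenchel_conjugate_attained)
  have inj: "x = y" if "grad f x = grad f y" for x y
    using grad_expansive[OF f, of x y] that \<mu> by (simp add: mult_le_0_iff)
  define G where "G = inv (grad f)"
  have surj: "surj (grad f)" using grad_surjective[OF f \<mu>] by (metis surjI)
  have G: "grad f (G z) = z" for z unfolding G_def using surj by (rule surj_f_inv_f)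
  have HG: "H z = G z \<bullet> z - f (G z)" for z using H[of "G z"] by (simp add: G)
  have lower: "H z + G z \<bullet> (w - z) + 1 / L / 2 * (norm (w - z))\<^sup>2 \<le> H w" for w z
  proof -
    (* v maximizes the minorant obtained by replacing f with its quadratic majorant at G z. *)
    define v where "v = G z + (1 / L) *\<^sub>R (w - z)"
    have "v \<bullet> w - f v \<le> H w"
    proof -
      have "0 \<le> \<mu> / 2 * (norm (v - G w))\<^sup>2" using \<mu> by simp
      then show ?thesis using smooth_strongly_convexD(1)[OF f, of "G w" v]
        by (simp add: HG G inner_diff inner_commute)
    qed
    moreover have "f v \<le> f (G z) + z \<bullet> (v - G z) + L / 2 * (norm (v - G z))\<^sup>2"
      using smooth_strongly_convexD(2)[OF f, of v "G z"] by (simp add: G)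
    moreover have "L / 2 * (norm (v - G z))\<^sup>2 = 1 / L / 2 * (norm (w - z))\<^sup>2"
      using L by (simp add: v_def power_mult_distrib power_divide power2_eq_square)
    moreover have "v \<bullet> w - z \<bullet> (v - G z) = G z \<bullet> w + 1 / L * (norm (w - z))\<^sup>2"
      by (simp add: v_def power2_norm_eq_inner inner_diff inner_add inner_commute algebra_simps)
    ultimately show ?thesis by (simp add: HG inner_diff)
  qed
  have upper: "H w \<le> H z + G z \<bullet> (w - z) + 1 / \<mu> / 2 * (norm (w - z))\<^sup>2" for w z
  proof -
    define h where "h = G w - G z"
    have "f (G z) + z \<bullet> h + \<mu> / 2 * (norm h)\<^sup>2 \<le> f (G w)"
      using smooth_strongly_convexD(1)[OF f, of "G z" "G w"] by (simp add: G h_def)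
    moreover have "h \<bullet> (w - z) - \<mu> / 2 * (norm h)\<^sup>2 \<le> 1 / \<mu> / 2 * (norm (w - z))\<^sup>2"
    proof -
      have "0 \<le> (norm (\<mu> *\<^sub>R h - (w - z)))\<^sup>2 / (2 * \<mu>)" using \<mu> by simp
      also have "\<dots> = \<mu> / 2 * (norm h)\<^sup>2 - h \<bullet> (w - z) + 1 / \<mu> / 2 * (norm (w - z))\<^sup>2"
      proof -
        have "(norm (\<mu> *\<^sub>R h - u))\<^sup>2 = \<mu>\<^sup>2 * (norm h)\<^sup>2 - 2 * \<mu> * (h \<bullet> u) + (norm u)\<^sup>2" for u
          unfolding power2_norm_eq_inner
          by (simp add: inner_diff inner_commute[of u h] algebra_simps power2_eq_square)
        then show ?thesis using \<mu>
          by (simp only:) (simp add: add_divide_distrib diff_divide_distrib power2_eq_square)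
      qed
      finally show ?thesis by linarith
    qed
    ultimately show ?thesis by (simp add: HG h_def inner_diff inner_commute)
  qed
  show "smooth_strongly_convex (1 / \<mu>) (1 / L) (fenchel_conjugate f)"
    unfolding H_def[symmetric]
    using smooth_strongly_convexI(1)[of "1 / L" "1 / \<mu>" H G] lower upper \<mu> L by simp
  have "grad H = G"
    using smooth_strongly_convexI(2)[of "1 / L" "1 / \<mu>" H G] lower upper \<mu> L by simp
  then show "grad (fenchel_conjugate f) (grad f x) = x"
    using G inj unfolding H_def by metis
qed

lemma smooth_strongly_convex_separable_sum:
  fixes f :: "'n::finite \<Rightarrow> 'a::real_inner \<Rightarrow> real"
  assumes f: "\<And>i. smooth_strongly_convex L \<mu> (f i)" and "0 \<le> \<mu>" "0 \<le> L"
  shows "smooth_strongly_convex L \<mu> (separable_sum f)"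
proof (rule smooth_strongly_convexI(1)[where D = "\<lambda>y. \<chi> i. grad (f i) (y $ i)"])
  have norm_sq: "(norm x)\<^sup>2 = (\<Sum>i\<in>UNIV. (norm (x $ i))\<^sup>2)" for x :: "'a ^ 'n"
    by (simp add: power2_norm_eq_inner inner_vec_def)
  fix x y :: "'a ^ 'n"
  show "separable_sum f y + (\<chi> i. grad (f i) (y $ i)) \<bullet> (x - y) + \<mu> / 2 * (norm (x - y))\<^sup>2
      \<le> separable_sum f x"
    using smooth_strongly_convexD(1)[OF f]
    by (simp only: separable_sum_def norm_sq inner_vec_def sum_distrib_left flip: sum.distrib)
       (simp add: sum_mono)
  show "separable_sum f x
      \<le> separable_sum f y + (\<chi> i. grad (f i) (y $ i)) \<bullet> (x - y) + L / 2 * (norm (x - y))\<^sup>2"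
    using smooth_strongly_convexD(2)[OF f]
    by (simp only: separable_sum_def norm_sq inner_vec_def sum_distrib_left flip: sum.distrib)
       (simp add: sum_mono)
qed (use assms in auto)

section \<open>Spectra of symmetric matrices\<close>

text \<open>The minimizer \<open>v\<close> of the Rayleigh quotient over the unit vectors of \<open>S\<close>, with minimum \<open>l\<close>, is an
  eigenvector: along the line through \<open>v\<close> in direction \<open>w = T v - l *\<^sub>R v\<close>, which stays in \<open>S\<close>,
  the form \<open>x \<bullet> T x - l * (norm x)\<^sup>2\<close> is nonnegative and has linear coefficient
  \<open>2 * (norm w)\<^sup>2\<close>.\<close>

lemma self_adjoint_min_eigenvector:
  fixes T :: "'a::euclidean_space \<Rightarrow> 'a"
  assumes T: "linear T" and adj: "\<And>x y. x \<bullet> T y = T x \<bullet> y"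
    and S: "subspace S" "S \<noteq> {0}" and inv: "\<And>x. x \<in> S \<Longrightarrow> T x \<in> S"
  obtains v l where "v \<in> S" "v \<noteq> 0" "T v = l *\<^sub>R v" "\<And>x. x \<in> S \<Longrightarrow> l * (norm x)\<^sup>2 \<le> x \<bullet> T x"
proof -
  interpret linear T by (rule T)
  have "\<exists>v\<in>S \<inter> sphere 0 1. \<forall>y\<in>S \<inter> sphere 0 1. v \<bullet> T v \<le> y \<bullet> T y"
  proof (rule continuous_attains_inf)
    show "compact (S \<inter> sphere 0 1)"
      by (intro closed_Int_compact closed_subspace S compact_sphere)
    obtain x where x: "x \<in> S" "x \<noteq> 0" using S subspace_0 by blast
    then have "(1 / norm x) *\<^sub>R x \<in> S \<inter> sphere 0 1" using S(1) by (simp add: subspace_scale)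
    then show "S \<inter> sphere 0 1 \<noteq> {}" by blast
    show "continuous_on (S \<inter> sphere 0 1) (\<lambda>x. x \<bullet> T x)"
      by (intro continuous_intros linear_continuous_on linear_conv_bounded_linear[THEN iffD1] T)
  qed
  then obtain v where v: "v \<in> S" "norm v = 1"
    and min: "\<And>y. y \<in> S \<Longrightarrow> norm y = 1 \<Longrightarrow> v \<bullet> T v \<le> y \<bullet> T y" by auto
  define l where "l = v \<bullet> T v"
  have quotient: "l * (norm x)\<^sup>2 \<le> x \<bullet> T x" if "x \<in> S" for x
  proof (cases "x = 0")
    case False
    have "l \<le> ((1 / norm x) *\<^sub>R x) \<bullet> T ((1 / norm x) *\<^sub>R x)"
      unfolding l_def using that S(1) False by (intro min) (auto simp: subspace_scale)
    then show ?thesis using False by (simp add: scale field_simps power2_eq_square)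
  qed (simp add: zero)
  define w where "w = T v - l *\<^sub>R v"
  have w: "w \<in> S" unfolding w_def using v S inv by (intro subspace_diff subspace_scale)
  have "2 * (norm w)\<^sup>2 = 0"
  proof (rule quadratic_nonneg_imp_linear_coeff_zero)
    fix t
    have "v + t *\<^sub>R w \<in> S" using v w S by (intro subspace_add subspace_scale)
    then have "l * (norm (v + t *\<^sub>R w))\<^sup>2 \<le> (v + t *\<^sub>R w) \<bullet> T (v + t *\<^sub>R w)"
      by (rule quotient)
    moreover have "(norm (v + t *\<^sub>R w))\<^sup>2 = 1 + 2 * t * (v \<bullet> w) + (norm w)\<^sup>2 * t\<^sup>2"
      using v(2) norm_eq_1[of v] unfolding power2_norm_eq_inner
      by (simp add: inner_add inner_commute[of w v] algebra_simps power2_eq_square)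
    moreover have "(v + t *\<^sub>R w) \<bullet> T (v + t *\<^sub>R w) = l + 2 * t * (T v \<bullet> w) + (w \<bullet> T w) * t\<^sup>2"
      using adj[of v w]
      by (simp add: add scale inner_add inner_commute[of w "T v"] l_def algebra_simps
          power2_eq_square)
    moreover have "T v \<bullet> w = (norm w)\<^sup>2 + l * (v \<bullet> w)"
      unfolding power2_norm_eq_inner by (simp add: w_def inner_diff_left)
    ultimately show "0 \<le> 2 * (norm w)\<^sup>2 * t + (w \<bullet> T w - l * (norm w)\<^sup>2) * t\<^sup>2"
      by (simp add: algebra_simps)
  qed
  then have "T v = l *\<^sub>R v" by (simp add: w_def)
  then show thesis using that v quotient by (metis norm_zero zero_neq_one)
qed

lemma matrix_self_adjoint:
  fixes A :: "real ^ 'n ^ 'n"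
  assumes "transpose A = A"
  shows "x \<bullet> (A *v y) = (A *v x) \<bullet> y"
  by (metis assms dot_lmul_matrix transpose_matrix_vector)

text \<open>Eigenvectors of distinct eigenvalues are orthogonal, hence independent. Finiteness is what makes
  the \<open>Min\<close> and \<open>Max\<close> in the spectral bounds meaningful.\<close>

lemma finite_eigenvalues_symmetric:
  fixes A :: "real ^ 'n ^ 'n"
  assumes A: "transpose A = A"
  shows "finite (eigenvalues A)"
proof -
  define e where "e l = (SOME v. v \<noteq> 0 \<and> A *v v = l *\<^sub>R v)" for l
  have e: "e l \<noteq> 0 \<and> A *v e l = l *\<^sub>R e l" if "l \<in> eigenvalues A" for l
    unfolding e_def using that
    by (metis (mono_tags, lifting) eigenvalues_def mem_Collect_eq someI_ex)
  have orth: "e l \<bullet> e k = 0" if "l \<in> eigenvalues A" "k \<in> eigenvalues A" "l \<noteq> k" for l k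
    using matrix_self_adjoint[OF A, of "e l" "e k"] e[OF that(1)] e[OF that(2)] that(3) by simp
  have inj: "inj_on e (eigenvalues A)"
  proof (rule inj_onI, rule ccontr)
    fix l k assume lk: "l \<in> eigenvalues A" "k \<in> eigenvalues A" "e l = e k" "l \<noteq> k"
    then have "e l \<bullet> e l = 0" using orth by metis
    then show False using e lk(1) by simp
  qed
  have "independent (e ` eigenvalues A)"
    using e orth by (intro pairwise_orthogonal_independent) (auto simp: pairwise_def orthogonal_def)
  then show ?thesis using inj independent_bound finite_imageD by blast
qed

lemma symmetric_le_Max_eigenvalue:
  fixes A :: "real ^ 'n::finite ^ 'n"
  assumes A: "transpose A = A"
  shows "x \<bullet> (A *v x) \<le> Max (eigenvalues A) * (norm x)\<^sup>2"
proof -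
  (* The least eigenvalue of - A is minus the largest one of A. *)
  define T where "T x = - (A *v x)" for x
  have lin: "linear T" unfolding T_def by (intro linear_compose_neg matrix_vector_mul_linear)
  have adj: "x \<bullet> T y = T x \<bullet> y" for x y
    unfolding T_def using matrix_self_adjoint[OF A, of x y] by simp
  have nonzero: "UNIV \<noteq> {0 :: real ^ 'n}" using UNIV_not_singleton by blast
  obtain v l where v: "v \<noteq> 0" "T v = l *\<^sub>R v" and l: "\<And>x. l * (norm x)\<^sup>2 \<le> x \<bullet> T x"
  proof (rule self_adjoint_min_eigenvector[OF lin adj subspace_UNIV nonzero UNIV_I])
    fix v l
    assume "v \<noteq> 0" "T v = l *\<^sub>R v" "\<And>x. x \<in> UNIV \<Longrightarrow> l * (norm x)\<^sup>2 \<le> x \<bullet> T x"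
    then show thesis by (intro that[of v l]) simp_all
  qed
  have "A *v v = (- l) *\<^sub>R v"
    using v(2) unfolding T_def by (metis add.inverse_inverse scaleR_minus_left)
  then have "- l \<in> eigenvalues A" using v(1) by (auto simp: eigenvalues_def)
  then have "- l \<le> Max (eigenvalues A)" by (intro Max_ge finite_eigenvalues_symmetric A)
  then have "- l * (norm x)\<^sup>2 \<le> Max (eigenvalues A) * (norm x)\<^sup>2" by (intro mult_right_mono) auto
  then show ?thesis using l[of x] by (simp add: T_def)
qed

text \<open>This says that the square of \<open>T\<close> is at most \<open>b\<close> times \<open>T\<close>. It follows from nonnegativity of the
  quadratic form at \<open>x - (1 / b) *\<^sub>R T x\<close>, without diagonalizing \<open>T\<close>.\<close>

lemma psd_image_norm_le:
  fixes T :: "'a::real_inner \<Rightarrow> 'a"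
  assumes T: "linear T" and adj: "\<And>x y. x \<bullet> T y = T x \<bullet> y"
    and psd: "\<And>x. 0 \<le> x \<bullet> T x" and le: "\<And>x. x \<bullet> T x \<le> b * (norm x)\<^sup>2" and b: "0 < b"
  shows "(norm (T x))\<^sup>2 \<le> b * (x \<bullet> T x)"
proof -
  interpret linear T by (rule T)
  define y where "y = x - (1 / b) *\<^sub>R T x"
  have "0 \<le> y \<bullet> T y" by (rule psd)
  also have "\<dots> = x \<bullet> T x - 2 / b * (norm (T x))\<^sup>2 + (1 / b)\<^sup>2 * (T x \<bullet> T (T x))"
    unfolding power2_norm_eq_inner
    by (simp add: y_def diff scale inner_diff adj[of x "T x"] power2_eq_square algebra_simps)
  also have "\<dots> \<le> x \<bullet> T x - 2 / b * (norm (T x))\<^sup>2 + (1 / b)\<^sup>2 * (b * (norm (T x))\<^sup>2)"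
    by (intro add_left_mono mult_left_mono le) auto
  also have "\<dots> = x \<bullet> T x - (norm (T x))\<^sup>2 / b" using b by (simp add: power2_eq_square field_simps)
  finally show ?thesis using b by (simp add: field_simps)
qed

section \<open>Gossip matrices and their block action\<close>

lemma subspace_consensus: "subspace (consensus :: ('a::real_vector ^ 'n) set)"
  unfolding subspace_def consensus_def by simp metis

lemma consensusD: "x \<in> consensus \<Longrightarrow> x $ i = x $ j"
  unfolding consensus_def by blast

lemma gossip_matrix_norm_le:
  fixes A :: "real ^ 'n::finite ^ 'n"
  assumes A: "gossip_matrix E A" and bounds: "spectral_bounds lmin lmax A" and "0 < lmax"
  shows "(norm (A *v x))\<^sup>2 \<le> lmax * (x \<bullet> (A *v x))"
proof (rule psd_image_norm_le)
  have sym: "transpose A = A" and psd: "\<And>x. 0 \<le> x \<bullet> (A *v x)"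
    using A by (auto simp: gossip_matrix_def)
  fix x y
  show "x \<bullet> (A *v y) = (A *v x) \<bullet> y" by (rule matrix_self_adjoint[OF sym])
  show "0 \<le> x \<bullet> (A *v x)" by (rule psd)
  have "x \<bullet> (A *v x) \<le> Max (eigenvalues A) * (norm x)\<^sup>2"
    by (rule symmetric_le_Max_eigenvalue[OF sym])
  also have "\<dots> \<le> lmax * (norm x)\<^sup>2"
    using bounds by (intro mult_right_mono) (auto simp: spectral_bounds_def)
  finally show "x \<bullet> (A *v x) \<le> lmax * (norm x)\<^sup>2" .
qed (use assms in auto)

text \<open>\<open>A\<close> maps the complement of its kernel into itself, and its least eigenvalue there is positive,
  hence one of those over which the minimum in the spectral bound is taken.\<close>

lemma gossip_matrix_coercive:
  fixes A :: "real ^ 'n::finite ^ 'n"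
  assumes A: "gossip_matrix E A" and bounds: "spectral_bounds lmin lmax A"
    and x: "x \<in> consensus\<^sup>\<bottom>"
  shows "lmin * (norm x)\<^sup>2 \<le> x \<bullet> (A *v x)"
proof (cases "(consensus :: (real ^ 'n) set)\<^sup>\<bottom> = {0}")
  case True
  then show ?thesis using x by simp
next
  case False
  have sym: "transpose A = A" and psd: "\<And>x. 0 \<le> x \<bullet> (A *v x)"
    and ker: "\<And>x. A *v x = 0 \<longleftrightarrow> x \<in> consensus"
    using A by (auto simp: gossip_matrix_def)
  note adj = matrix_self_adjoint[OF sym]
  have inv: "A *v x \<in> consensus\<^sup>\<bottom>" for x
  proof -
    have "y \<bullet> (A *v x) = 0" if "y \<in> consensus" for y
      using that unfolding adj by (simp flip: ker)
    then show ?thesis by (simp add: orthogonal_comp_def orthogonal_def)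
  qed
  obtain v l where v: "v \<in> consensus\<^sup>\<bottom>" "v \<noteq> 0" "A *v v = l *\<^sub>R v"
    and l: "\<And>x. x \<in> consensus\<^sup>\<bottom> \<Longrightarrow> l * (norm x)\<^sup>2 \<le> x \<bullet> (A *v x)"
    using self_adjoint_min_eigenvector[OF matrix_vector_mul_linear adj subspace_orthogonal_comp
        False inv] by metis
  have "0 < v \<bullet> v" using v(2) by simp
  then have "0 \<le> l" using psd[of v] unfolding v(3) inner_scaleR_right
    by (simp only: zero_le_mult_iff) linarith
  moreover have "l \<noteq> 0"
  proof
    assume "l = 0"
    then have "v \<in> consensus" using ker v(3) by simp
    then show False using v(1,2) by (auto simp: orthogonal_comp_def orthogonal_def)
  qed
  ultimately have "l \<in> {l \<in> eigenvalues A. 0 < l}" using v by (auto simp: eigenvalues_def)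
  then have "Min {l \<in> eigenvalues A. 0 < l} \<le> l"
    using finite_eigenvalues_symmetric[OF sym] by (intro Min_le) auto
  then have "lmin \<le> l" using bounds by (simp add: spectral_bounds_def)
  then have "lmin * (norm x)\<^sup>2 \<le> l * (norm x)\<^sup>2" by (intro mult_right_mono) auto
  then show ?thesis using l[OF x] by simp
qed

text \<open>Through these slices, the Kronecker product with an identity becomes independent copies of the
  matrix, and every bound for the block action is a sum of bounds for the matrix itself.\<close>

definition coordinate :: "'d \<Rightarrow> real ^ 'd ^ 'n \<Rightarrow> real ^ 'n" where
  "coordinate c x = (\<chi> i. x $ i $ c)"

lemma inner_eq_sum_coordinates: "x \<bullet> y = (\<Sum>c\<in>UNIV. coordinate c x \<bullet> coordinate c y)"
  for x y :: "real ^ 'd::finite ^ 'n::finite"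
  unfolding inner_vec_def coordinate_def by (simp, rule sum.swap)

lemma norm_squared_eq_sum_coordinates: "(norm x)\<^sup>2 = (\<Sum>c\<in>UNIV. (norm (coordinate c x))\<^sup>2)"
  for x :: "real ^ 'd::finite ^ 'n::finite"
  by (simp add: power2_norm_eq_inner inner_eq_sum_coordinates)

lemma coordinate_block_action: "coordinate c (block_action A x) = A *v coordinate c x"
  by (simp add: vec_eq_iff coordinate_def block_action_def matrix_vector_mult_def)

lemma coordinate_consensus: "x \<in> consensus \<Longrightarrow> coordinate c x \<in> consensus"
  unfolding consensus_def coordinate_def by simp metis

text \<open>A consensus vector \<open>u\<close> of scalars, put into slice \<open>c\<close> and zero elsewhere, is a consensus vector of
  blocks; testing \<open>x\<close> against it tests the slice of \<open>x\<close> against \<open>u\<close>.\<close>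

lemma coordinate_consensus_comp:
  fixes x :: "real ^ 'd::finite ^ 'n::finite"
  assumes x: "x \<in> consensus\<^sup>\<bottom>"
  shows "coordinate c x \<in> consensus\<^sup>\<bottom>"
proof -
  have "u \<bullet> coordinate c x = 0" if u: "u \<in> consensus" for u
  proof -
    define y :: "real ^ 'd ^ 'n" where "y = (\<chi> i. axis c (u $ i))"
    have "y \<in> consensus" using consensusD[OF u] unfolding consensus_def y_def by simp metis
    then have "0 = y \<bullet> x" using x by (simp add: orthogonal_comp_def orthogonal_def)
    also have "\<dots> = (\<Sum>i\<in>UNIV. axis c (u $ i) \<bullet> x $ i)"
      unfolding inner_vec_def[of y] by (simp add: y_def)
    also have "\<dots> = u \<bullet> coordinate c x"
      unfolding inner_vec_def[of u] by (simp add: coordinate_def inner_axis')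
    finally show ?thesis by simp
  qed
  then show ?thesis by (simp add: orthogonal_comp_def orthogonal_def)
qed

lemma linear_block_action: "linear (block_action A)"
  by (rule linearI)
    (simp_all add: vec_eq_iff block_action_def scaleR_add_right sum.distrib scaleR_sum_right
      mult.commute)

lemma block_action_norm_le:
  fixes x :: "real ^ 'd::finite ^ 'n::finite"
  assumes "gossip_matrix E A" "spectral_bounds lmin lmax A" "0 < lmax"
  shows "(norm (block_action A x))\<^sup>2 \<le> lmax * (x \<bullet> block_action A x)"
  unfolding norm_squared_eq_sum_coordinates inner_eq_sum_coordinates[of x] sum_distrib_left
    coordinate_block_action
  by (intro sum_mono gossip_matrix_norm_le[OF assms])

lemma block_action_coercive:
  fixes x :: "real ^ 'd::finite ^ 'n::finite"
  assumes "gossip_matrix E A" "spectral_bounds lmin lmax A" "x \<in> consensus\<^sup>\<bottom>"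
  shows "lmin * (norm x)\<^sup>2 \<le> x \<bullet> block_action A x"
  unfolding norm_squared_eq_sum_coordinates[of x] inner_eq_sum_coordinates[of x] sum_distrib_left
    coordinate_block_action
  using assms by (intro sum_mono gossip_matrix_coercive coordinate_consensus_comp)

lemma block_action_consensus:
  fixes x :: "real ^ 'd::finite ^ 'n::finite"
  assumes A: "gossip_matrix E A" and x: "x \<in> consensus"
  shows "block_action A x = 0"
proof -
  have "A *v coordinate c x = 0" for c
    using A coordinate_consensus[OF x, of c] by (auto simp: gossip_matrix_def)
  then have "norm (block_action A x) ^ 2 = 0"
    unfolding norm_squared_eq_sum_coordinates coordinate_block_action by simp
  then show ?thesis by simp
qed

lemma block_action_in_consensus_comp:
  fixes x :: "real ^ 'd::finite ^ 'n::finite"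
  assumes A: "gossip_matrix E A"
  shows "block_action A x \<in> consensus\<^sup>\<bottom>"
proof -
  have sym: "transpose A = A" using A by (simp add: gossip_matrix_def)
  have "y \<bullet> block_action A x = 0" if "y \<in> consensus" for y
  proof -
    have "y \<bullet> block_action A x = block_action A y \<bullet> x"
      unfolding inner_eq_sum_coordinates[of y] inner_eq_sum_coordinates[of "block_action A y"]
        coordinate_block_action by (simp add: matrix_self_adjoint[OF sym])
    then show ?thesis using block_action_consensus[OF A that] by simp
  qed
  then show ?thesis by (simp add: orthogonal_comp_def orthogonal_def)
qed

text \<open>The orthogonal projector onto the complement of the consensus subspace.\<close>

definition centered :: "'a::real_vector ^ 'n::finite \<Rightarrow> 'a ^ 'n" where
  "centered x = (\<chi> i. x $ i - (1 / CARD('n)) *\<^sub>R (\<Sum>j\<in>UNIV. x $ j))"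

lemma linear_centered: "linear centered"
  by (rule linearI)
    (simp_all add: vec_eq_iff centered_def sum.distrib scaleR_diff_right algebra_simps
      flip: scaleR_sum_right)

lemma diff_centered_in_consensus: "x - centered x \<in> consensus"
  by (simp add: consensus_def centered_def)

lemma centered_in_consensus_comp: "centered x \<in> consensus\<^sup>\<bottom>"
  for x :: "'a::real_inner ^ 'n::finite"
proof -
  have "y \<bullet> centered x = 0" if y: "y \<in> consensus" for y
  proof -
    obtain i :: 'n where True by blast
    have "y \<bullet> centered x = (\<Sum>j\<in>UNIV. y $ i \<bullet> centered x $ j)"
      unfolding inner_vec_def by (intro sum.cong refl arg_cong2[where f = inner] consensusD[OF y])
    also have "\<dots> = y $ i \<bullet> (\<Sum>j\<in>UNIV. centered x $ j)" by (simp add: inner_sum_right)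
    also have "(\<Sum>j\<in>UNIV. centered x $ j) = 0"
      by (simp add: centered_def sum_subtractf sum_constant_scaleR)
    finally show ?thesis by simp
  qed
  then show ?thesis by (simp add: orthogonal_comp_def orthogonal_def)
qed

section \<open>Linear convergence of ADOM\<close>

lemma norm_convex_combination_squared_le:
  fixes a b :: "'a::real_inner"
  assumes "0 \<le> t" "t \<le> 1"
  shows "(norm ((1 - t) *\<^sub>R a + t *\<^sub>R b))\<^sup>2 \<le> (1 - t) * (norm a)\<^sup>2 + t * (norm b)\<^sup>2"
proof -
  have "(1 - t) * (norm a)\<^sup>2 + t * (norm b)\<^sup>2 - (norm ((1 - t) *\<^sub>R a + t *\<^sub>R b))\<^sup>2
      = t * (1 - t) * (norm (a - b))\<^sup>2"
    unfolding power2_norm_eq_inner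
    by (simp add: inner_add inner_diff inner_commute[of b a] algebra_simps power2_eq_square)
  also have "\<dots> \<ge> 0" using assms by simp
  finally show ?thesis by simp
qed

lemma norm_add_squared_le: "(norm (a + b))\<^sup>2 \<le> 2 * (norm a)\<^sup>2 + 2 * (norm b)\<^sup>2"
  for a b :: "'a::real_inner"
proof -
  have "2 * (norm a)\<^sup>2 + 2 * (norm b)\<^sup>2 - (norm (a + b))\<^sup>2 = (norm (a - b))\<^sup>2"
    unfolding power2_norm_eq_inner by (simp add: inner_add inner_diff inner_commute[of b a])
  then show ?thesis by (metis diff_ge_0_iff_ge zero_le_power2)
qed

lemma two_mult_le_weighted_squares:
  fixes x y q :: real
  assumes "0 < q"
  shows "2 * (x * y) \<le> x\<^sup>2 / q + q * y\<^sup>2"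
proof -
  have "x\<^sup>2 / q + q * y\<^sup>2 - 2 * (x * y) = (x - q * y)\<^sup>2 / q"
    using assms by (simp add: field_simps power2_eq_square)
  also have "\<dots> \<ge> 0" using assms by simp
  finally show ?thesis by simp
qed

text \<open>The part of the argument that sees nothing of the network but the subspace \<open>S\<close> of zero-sum
  vectors with its orthogonal projector \<open>P\<close>. The function \<open>H\<close> plays the role of the conjugate and
  \<open>zs\<close> that of its minimizer over \<open>S\<close>: all dual iterates stay in \<open>S\<close>, so only the component of
  the gradient in \<open>S\<close> has to vanish at \<open>zs\<close>.\<close>

locale adom =
  fixes S :: "'a::euclidean_space set" and P :: "'a \<Rightarrow> 'a" and W :: "nat \<Rightarrow> 'a \<Rightarrow> 'a"
    and H :: "'a \<Rightarrow> real" and zs :: 'a and L \<mu> lmin lmax \<alpha> \<eta> \<theta> \<sigma> \<tau> :: real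
    and z m zf zg \<Delta> :: "nat \<Rightarrow> 'a"
  assumes S: "subspace S"
    and P: "linear P" "\<And>x. P x \<in> S" "\<And>s x. s \<in> S \<Longrightarrow> s \<bullet> P x = s \<bullet> x"
    and W: "\<And>k x. W k x \<in> S" "\<And>k x. W k (P x) = W k x"
    and W_norm: "\<And>k x. (norm (W k x))\<^sup>2 \<le> lmax * (x \<bullet> W k x)"
    and W_coercive: "\<And>k x. x \<in> S \<Longrightarrow> lmin * (norm x)\<^sup>2 \<le> x \<bullet> W k x"
    and H: "smooth_strongly_convex (1 / \<mu>) (1 / L) H"
    and zs: "zs \<in> S" "\<And>s. s \<in> S \<Longrightarrow> grad H zs \<bullet> s = 0"
    and constants: "0 < \<mu>" "\<mu> \<le> L" "0 < lmin" "lmin < lmax"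
    and \<alpha>: "\<alpha> = 1 / (2 * L)"
    and \<eta>: "\<eta> = 2 * lmin * sqrt (\<mu> * L) / (7 * lmax)"
    and \<theta>: "\<theta> = \<mu> / lmax"
    and \<sigma>: "\<sigma> = 1 / lmax"
    and \<tau>: "\<tau> = lmin / (7 * lmax) * sqrt (\<mu> / L)"
    and z0: "z 0 \<in> S"
    and iteration: "adom_iteration (grad H) W \<alpha> \<eta> \<theta> \<sigma> \<tau> z m zf zg \<Delta>"
begin

definition q :: real where "q = lmin / lmax"
definition g :: "nat \<Rightarrow> 'a" where "g k = grad H (zg k)"

text \<open>The communication terms \<open>\<Delta>\<close> cancel in \<open>z + P m\<close>. So \<open>zhat\<close> moves along the fully projected
  gradient \<open>P g\<close>, as in a method with exact projections, although each round applies only one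
  gossip operator; the part not yet transmitted is stored in \<open>m\<close>.\<close>

definition zhat :: "nat \<Rightarrow> 'a" where "zhat k = z k + P (m k)"

definition c :: real where "c = 2 * \<eta> * ((1 - \<tau>) / \<tau>)"

text \<open>With the weight \<open>c\<close>, the gap at \<open>zf\<close> enters \<open>distance_recursion\<close> with \<open>1 - \<tau>\<close> times its
  coefficient here, and the negative gap at \<open>zg\<close> suffices for \<open>dual_descent\<close> to produce the gap
  at the next \<open>zf\<close>. The weight of the memory term must be large enough for the contraction of
  \<open>P m\<close> to absorb the other terms in \<open>(norm (P (m k)))\<^sup>2\<close>, yet small enough for \<open>descent_gain\<close>
  to pay for the gradient that enters \<open>m\<close>; \<open>6\<close> is such a number.\<close>

definition lyapunov :: "nat \<Rightarrow> real" where
  "lyapunov k = (norm (zhat k - zs))\<^sup>2 + c * (H (zf k) - H zs) + 6 * (norm (P (m k)))\<^sup>2"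

lemma L_pos: "0 < L" using constants by simp
lemma q_bounds: "0 < q" "q < 1" using constants by (simp_all add: q_def)
lemma \<eta>_pos: "0 < \<eta>" unfolding \<eta> using constants by simp

lemma \<tau>_bounds: "0 < \<tau>" "\<tau> \<le> q / 7" "\<tau> \<le> 1 / 7"
proof -
  have "sqrt (\<mu> / L) \<le> 1" using constants by simp
  then have "q / 7 * sqrt (\<mu> / L) \<le> q / 7 * 1" using q_bounds by (intro mult_left_mono) auto
  then show "\<tau> \<le> q / 7" by (simp add: \<tau> q_def)
  then show "\<tau> \<le> 1 / 7" using q_bounds by simp
  show "0 < \<tau>" using constants by (simp add: \<tau>)
qed

text \<open>This coincidence of the parameters makes \<open>1 - \<tau>\<close> the common contraction factor of the distance
  and of the function value.\<close>

lemma \<eta>\<alpha>_eq_\<tau>: "\<eta> * \<alpha> = \<tau>"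
proof -
  have "sqrt (\<mu> * L) = sqrt (\<mu> / L * (L * L))" using L_pos by simp
  then have "sqrt (\<mu> * L) = sqrt (\<mu> / L) * L" using L_pos by (simp only: real_sqrt_mult) simp
  then show ?thesis using L_pos by (simp add: \<eta> \<alpha> \<tau>)
qed

lemma \<mu>q_eq: "\<mu> * q = 49 / 2 * \<tau> * \<eta> / q"
proof -
  have "sqrt (\<mu> / L) * sqrt (\<mu> * L) = sqrt (\<mu> * \<mu>)"
    using L_pos by (simp only: flip: real_sqrt_mult) simp
  also have "\<dots> = \<mu>" using constants(1) by simp
  finally have sq: "sqrt (\<mu> / L) * sqrt (\<mu> * L) = \<mu>" .
  have "\<tau> * \<eta> = 2 / 49 * q\<^sup>2 * (sqrt (\<mu> / L) * sqrt (\<mu> * L))"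
    by (simp add: \<tau> \<eta> q_def power2_eq_square)
  then show ?thesis unfolding sq using q_bounds by (simp add: field_simps power2_eq_square)
qed

lemma c_pos: "0 < c" unfolding c_def using \<eta>_pos \<tau>_bounds by simp

text \<open>The decrease of \<open>H\<close> in a gossip gradient step, weighted by \<open>c\<close>, dominates the multiples of
  \<open>(norm (P (g k)))\<^sup>2\<close> that the other two parts of the Lyapunov function produce together.\<close>

lemma descent_gain: "21 * \<eta>\<^sup>2 / q \<le> c * (\<theta> * lmin / 2)"
proof -
  have "c * (\<theta> * lmin / 2) = \<eta> * (1 - \<tau>) / \<tau> * (\<mu> * q)"
    by (simp add: c_def \<theta> q_def)
  also have "\<dots> = 49 / 2 * (1 - \<tau>) * (\<eta>\<^sup>2 / q)"
    unfolding \<mu>q_eq using \<tau>_bounds(1) by (simp add: power2_eq_square)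
  also have "\<dots> \<ge> 21 * (\<eta>\<^sup>2 / q)"
    using \<tau>_bounds(3) q_bounds by (intro mult_right_mono) auto
  finally show ?thesis by simp
qed

lemma P_eq_self: "x \<in> S \<Longrightarrow> P x = x"
proof -
  assume x: "x \<in> S"
  then have "x - P x \<in> S" using S P(2) by (simp add: subspace_diff)
  then have "(x - P x) \<bullet> (x - P x) = 0" using P(3)[of "x - P x" x] by (simp add: inner_diff_right)
  then show ?thesis by simp
qed

lemma step:
  shows "zf 0 = z 0"
    and "zg k = \<tau> *\<^sub>R z k + (1 - \<tau>) *\<^sub>R zf k"
    and "\<Delta> k = \<sigma> *\<^sub>R W k (m k - \<eta> *\<^sub>R g k)"
    and "m (Suc k) = m k - \<eta> *\<^sub>R g k - \<Delta> k"
    and "z (Suc k) = z k + \<tau> *\<^sub>R (zg k - z k) + \<Delta> k"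
    and "zf (Suc k) = zg k - \<theta> *\<^sub>R W k (g k)"
  using iteration unfolding adom_iteration_def g_def \<eta>\<alpha>_eq_\<tau> by blast+

lemma in_S: "z k \<in> S" "zf k \<in> S" "zg k \<in> S" "\<Delta> k \<in> S"
proof -
  have \<Delta>: "\<Delta> k \<in> S" for k unfolding step(3) by (intro subspace_scale S W)
  have "z k \<in> S \<and> zf k \<in> S"
  proof (induction k)
    case 0
    then show ?case using z0 by (simp add: step(1))
  next
    case (Suc k)
    then show ?case unfolding step(5,6) step(2)[of k]
      by (intro conjI subspace_add subspace_diff subspace_scale S W \<Delta>) auto
  qed
  then show zk: "z k \<in> S" "zf k \<in> S" by auto
  show "zg k \<in> S" unfolding step(2) by (intro subspace_add subspace_scale S zk)
  show "\<Delta> k \<in> S" by (rule \<Delta>)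
qed

text \<open>The gradient at \<open>zs\<close> annihilates \<open>S\<close>, so strong convexity leaves only the quadratic term.\<close>

lemma quadratic_growth:
  assumes "s \<in> S"
  shows "(norm (s - zs))\<^sup>2 / (2 * L) \<le> H s - H zs"
proof -
  have "grad H zs \<bullet> (s - zs) = 0" using assms zs S by (intro zs subspace_diff)
  then show ?thesis using smooth_strongly_convexD(1)[OF H, of zs s] by simp
qed

lemma gap_nonneg: "s \<in> S \<Longrightarrow> 0 \<le> H s - H zs"
  using quadratic_growth[of s] L_pos by (smt (verit) divide_nonneg_pos zero_le_power2)

text \<open>A gradient step preconditioned by a gossip operator. The bound \<open>W_norm\<close> makes the step length
  \<open>\<theta>\<close> admissible, and coercivity turns the decrease into one in terms of \<open>P g\<close>.\<close>

lemma dual_descent: "H (zf (Suc k)) \<le> H (zg k) - \<theta> * lmin / 2 * (norm (P (g k)))\<^sup>2"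
proof -
  define w where "w = W k (g k)"
  have lmax: "0 < lmax" using constants by simp
  have gw: "g k \<bullet> w = P (g k) \<bullet> w"
    using P(3)[OF W(1), of k "g k" "g k"] by (simp add: w_def inner_commute)
  have coercive: "lmin * (norm (P (g k)))\<^sup>2 \<le> g k \<bullet> w"
    unfolding gw using W_coercive[OF P(2), of "g k" k] by (simp add: w_def W(2))
  have "H (zf (Suc k)) \<le> H (zg k) - \<theta> * (g k \<bullet> w) + \<theta>\<^sup>2 / (2 * \<mu>) * (norm w)\<^sup>2"
    using smooth_strongly_convexD(2)[OF H, of "zf (Suc k)" "zg k"]
    by (simp add: step(6) g_def[symmetric] w_def[symmetric] power_mult_distrib)
  also have "\<theta>\<^sup>2 / (2 * \<mu>) * (norm w)\<^sup>2 \<le> \<theta>\<^sup>2 / (2 * \<mu>) * (lmax * (g k \<bullet> w))"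
    unfolding w_def using constants by (intro mult_left_mono W_norm) auto
  also have "\<dots> = \<theta> / 2 * (g k \<bullet> w)"
    using constants lmax by (simp add: \<theta> power2_eq_square)
  finally have "H (zf (Suc k)) \<le> H (zg k) - \<theta> / 2 * (g k \<bullet> w)" by simp
  also have "\<dots> \<le> H (zg k) - \<theta> / 2 * (lmin * (norm (P (g k)))\<^sup>2)"
    using coercive constants lmax by (intro diff_left_mono mult_left_mono) (auto simp: \<theta>)
  finally show ?thesis by simp
qed

text \<open>One gossip round removes from the memory, and from the new gradient stored in it, at least a
  fraction \<open>q\<close> of the squared projection onto \<open>S\<close>. Splitting the square of the sum with weight
  \<open>q / 2\<close> keeps half of that contraction for the memory.\<close>

lemma error_feedback_contraction:
  "(norm (P (m (Suc k))))\<^sup>2 \<le> (1 - q / 2) * (norm (P (m k)))\<^sup>2 + 2 / q * (\<eta> * norm (P (g k)))\<^sup>2"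
proof -
  define M where "M = norm (P (m k))"
  define a where "a = \<eta> * norm (P (g k))"
  define u where "u = P (m k - \<eta> *\<^sub>R g k)"
  define w where "w = W k u"
  have nonneg: "0 \<le> M" "0 \<le> a" using \<eta>_pos by (auto simp: M_def a_def)
  have lmax: "0 < lmax" using constants by simp
  have w: "w = W k (m k - \<eta> *\<^sub>R g k)" by (simp add: w_def u_def W(2))
  have "P (m (Suc k)) = u - P (\<Delta> k)"
    unfolding step(4) u_def by (simp add: linear_diff[OF P(1)])
  also have "P (\<Delta> k) = \<sigma> *\<^sub>R w" using P_eq_self[OF in_S(4)] by (simp add: step(3) w)
  finally have m: "P (m (Suc k)) = u - \<sigma> *\<^sub>R w" .
  have "(norm (P (m (Suc k))))\<^sup>2 = (norm u)\<^sup>2 - 2 * \<sigma> * (u \<bullet> w) + \<sigma>\<^sup>2 * (norm w)\<^sup>2"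
    unfolding m power2_norm_eq_inner
    by (simp add: inner_diff inner_commute[of w u] algebra_simps power2_eq_square)
  also have "\<sigma>\<^sup>2 * (norm w)\<^sup>2 \<le> \<sigma>\<^sup>2 * (lmax * (u \<bullet> w))"
    unfolding w_def by (intro mult_left_mono W_norm) simp
  also have "\<dots> = \<sigma> * (u \<bullet> w)" using lmax by (simp add: \<sigma> power2_eq_square)
  finally have "(norm (P (m (Suc k))))\<^sup>2 \<le> (norm u)\<^sup>2 - \<sigma> * (u \<bullet> w)" by simp
  also have "\<dots> \<le> (norm u)\<^sup>2 - \<sigma> * (lmin * (norm u)\<^sup>2)"
    unfolding w_def using lmax P(2) by (intro diff_left_mono mult_left_mono W_coercive)
      (auto simp: \<sigma> u_def)
  also have "\<dots> = (1 - q) * (norm u)\<^sup>2" by (simp add: \<sigma> q_def algebra_simps)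
  also have "\<dots> \<le> (1 - q) * (M + a)\<^sup>2"
  proof -
    have "norm u \<le> M + a"
      using norm_triangle_ineq4[of "P (m k)" "\<eta> *\<^sub>R P (g k)"] \<eta>_pos
      by (simp add: u_def M_def a_def linear_diff[OF P(1)] linear_scale[OF P(1)])
    then show ?thesis using q_bounds by (intro mult_left_mono power_mono) auto
  qed
  also have "\<dots> \<le> (1 - q) * ((1 + q / 2) * M\<^sup>2 + (1 + 2 / q) * a\<^sup>2)"
  proof (intro mult_left_mono)
    show "(M + a)\<^sup>2 \<le> (1 + q / 2) * M\<^sup>2 + (1 + 2 / q) * a\<^sup>2"
      using two_mult_le_weighted_squares[of "q / 2" a M] q_bounds
      by (simp add: power2_sum algebra_simps)
  qed (use q_bounds in auto)
  also have "\<dots> = (1 - q / 2) * M\<^sup>2 + 2 / q * a\<^sup>2 - (q\<^sup>2 / 2 * M\<^sup>2 + (1 + q) * a\<^sup>2)"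
    using q_bounds by (simp add: field_simps power2_eq_square)
  also have "\<dots> \<le> (1 - q / 2) * M\<^sup>2 + 2 / q * a\<^sup>2"
  proof -
    have "0 \<le> q\<^sup>2 / 2 * M\<^sup>2 + (1 + q) * a\<^sup>2" using q_bounds by simp
    then show ?thesis by linarith
  qed
  finally show ?thesis by (simp add: M_def a_def)
qed

text \<open>The mirror-type half of acceleration. The step of \<open>zhat\<close> starts from a convex combination of
  \<open>zhat\<close> with \<open>zg + P m\<close>; the price for \<open>zg\<close> is exactly paid by strong convexity of \<open>H\<close>, that
  for \<open>P m\<close> remains as an error. The linear term splits into the directions \<open>zg - zs\<close> and
  \<open>zg - zf\<close>, along which convexity gives function values.\<close>

lemma distance_recursion:
  "(norm (zhat (Suc k) - zs))\<^sup>2 \<le> (1 - \<tau>) * (norm (zhat k - zs))\<^sup>2 + 2 * \<tau> * (norm (P (m k)))\<^sup>2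
     - 2 * \<eta> * (H (zg k) - H zs) - c * (1 - \<tau>) * (H (zg k) - H (zf k))
     - 2 * \<eta> * (P (g k) \<bullet> P (m k)) + (\<eta> * norm (P (g k)))\<^sup>2"
proof -
  define y where "y = (1 - \<tau>) *\<^sub>R (zhat k - zs) + \<tau> *\<^sub>R (zg k + P (m k) - zs)"
  have P\<Delta>: "P (\<Delta> k) = \<Delta> k" by (rule P_eq_self[OF in_S(4)])
  have zhat_Suc: "zhat (Suc k) - zs = y - \<eta> *\<^sub>R P (g k)"
    unfolding zhat_def y_def step(4,5)
    by (simp only: linear_diff[OF P(1)] linear_scale[OF P(1)] P\<Delta>) (simp add: algebra_simps)
  have expand: "(norm (zhat (Suc k) - zs))\<^sup>2
      = (norm y)\<^sup>2 - 2 * \<eta> * (P (g k) \<bullet> y) + (\<eta> * norm (P (g k)))\<^sup>2"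
    unfolding zhat_Suc power_mult_distrib power2_norm_eq_inner
    by (simp add: inner_diff inner_commute[of y "P (g k)"] algebra_simps power2_eq_square)
  have "(norm y)\<^sup>2 \<le> (1 - \<tau>) * (norm (zhat k - zs))\<^sup>2 + \<tau> * (norm (zg k + P (m k) - zs))\<^sup>2"
    unfolding y_def using \<tau>_bounds by (intro norm_convex_combination_squared_le) auto
  moreover have "\<tau> * (norm (zg k + P (m k) - zs))\<^sup>2
      \<le> \<tau> * (2 * (norm (zg k - zs))\<^sup>2 + 2 * (norm (P (m k)))\<^sup>2)"
    using norm_add_squared_le[of "zg k - zs" "P (m k)"] \<tau>_bounds(1)
    by (intro mult_left_mono) (auto simp: algebra_simps)
  ultimately have norm_y: "(norm y)\<^sup>2 \<le> (1 - \<tau>) * (norm (zhat k - zs))\<^sup>2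
      + 2 * \<tau> * (norm (zg k - zs))\<^sup>2 + 2 * \<tau> * (norm (P (m k)))\<^sup>2"
    by (simp add: algebra_simps)
  (* The coupling step, solved for z, exposes the direction zg - zf. *)
  have z: "z k - zg k = ((1 - \<tau>) / \<tau>) *\<^sub>R (zg k - zf k)"
  proof -
    have "\<tau> *\<^sub>R (z k - zg k) = (1 - \<tau>) *\<^sub>R (zg k - zf k)"
      unfolding step(2)[of k] by (simp add: algebra_simps)
    then have "(1 / \<tau>) *\<^sub>R \<tau> *\<^sub>R (z k - zg k) = (1 / \<tau>) *\<^sub>R (1 - \<tau>) *\<^sub>R (zg k - zf k)"
      by simp
    then show ?thesis using \<tau>_bounds(1) by simp
  qed
  have y: "y = (zg k - zs) + (1 - \<tau>) *\<^sub>R (z k - zg k) + P (m k)"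
    by (simp add: y_def zhat_def algebra_simps)
  have proj: "P (g k) \<bullet> s = g k \<bullet> s" if "s \<in> S" for s
    using P(3)[OF that] by (simp add: inner_commute)
  have "P (g k) \<bullet> y = g k \<bullet> (zg k - zs) + (1 - \<tau>) * ((1 - \<tau>) / \<tau>) * (g k \<bullet> (zg k - zf k))
      + P (g k) \<bullet> P (m k)"
    unfolding y z
    by (simp only: inner_add_right inner_scaleR_right)
       (simp add: proj subspace_diff[OF S] in_S zs(1))
  then have "2 * \<eta> * (P (g k) \<bullet> y) = 2 * \<eta> * (g k \<bullet> (zg k - zs))
      + c * (1 - \<tau>) * (g k \<bullet> (zg k - zf k)) + 2 * \<eta> * (P (g k) \<bullet> P (m k))"
    by (simp only: c_def distrib_left mult_ac)
  moreover have "2 * \<eta> * (g k \<bullet> (zg k - zs))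
      \<ge> 2 * \<eta> * (H (zg k) - H zs) + 2 * \<tau> * (norm (zg k - zs))\<^sup>2"
  proof -
    have "H (zg k) - H zs + 1 / L / 2 * (norm (zg k - zs))\<^sup>2 \<le> g k \<bullet> (zg k - zs)"
      using smooth_strongly_convexD(1)[OF H, of "zg k" zs]
      by (simp add: g_def inner_diff norm_minus_commute[of zs])
    then have "2 * \<eta> * (H (zg k) - H zs + 1 / L / 2 * (norm (zg k - zs))\<^sup>2)
        \<le> 2 * \<eta> * (g k \<bullet> (zg k - zs))" using \<eta>_pos by (intro mult_left_mono) auto
    (* Twice \<tau> is the coefficient of the squared distance of zg to zs in norm_y, so they cancel. *)
    moreover have "2 * \<eta> * (1 / L / 2) = 2 * \<tau>" by (simp add: \<eta>\<alpha>_eq_\<tau>[symmetric] \<alpha>)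
    ultimately show ?thesis by (metis distrib_left mult.assoc)
  qed
  moreover have "c * (1 - \<tau>) * (H (zg k) - H (zf k)) \<le> c * (1 - \<tau>) * (g k \<bullet> (zg k - zf k))"
  proof (intro mult_left_mono)
    have "0 \<le> 1 / L / 2 * (norm (zf k - zg k))\<^sup>2" using L_pos by simp
    then show "H (zg k) - H (zf k) \<le> g k \<bullet> (zg k - zf k)"
      using smooth_strongly_convexD(1)[OF H, of "zg k" "zf k"] by (simp add: g_def inner_diff)
  qed (use c_pos \<tau>_bounds in auto)
  ultimately show ?thesis using expand norm_y by linarith
qed

text \<open>In the sum of \<open>distance_recursion\<close>, \<open>c\<close> times \<open>dual_descent\<close> and \<open>6\<close> times
  \<open>error_feedback_contraction\<close>, the cross term of gradient and memory is split by weight \<open>q\<close>.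
  The memory then has coefficient \<open>2 * \<tau> + q + 6 - 3 * q\<close>, at most \<open>6 * (1 - \<tau>)\<close> because
  \<open>7 * \<tau> \<le> q\<close>; the gradient has coefficient at most \<open>(1 + 1 + 12 - 21) / q\<close>, which is negative,
  times \<open>(\<eta> * norm (P (g k)))\<^sup>2\<close>; and the gap at \<open>zg\<close> has coefficient
  \<open>c * \<tau> - 2 * \<eta> \<le> 0\<close>.\<close>

lemma lyapunov_contraction: "lyapunov (Suc k) \<le> (1 - \<tau>) * lyapunov k"
proof -
  define M where "M = norm (P (m k))"
  define a where "a = \<eta> * norm (P (g k))"
  define A where "A = (norm (zhat k - zs))\<^sup>2"
  define Df where "Df = H (zf k) - H zs"
  define Dg where "Dg = H (zg k) - H zs"
  have "2 * \<eta> * - (P (g k) \<bullet> P (m k)) \<le> 2 * \<eta> * (norm (P (g k)) * M)"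
    using Cauchy_Schwarz_ineq2[of "P (g k)" "P (m k)"] \<eta>_pos
    by (intro mult_left_mono) (auto simp: M_def)
  also have "\<dots> = 2 * (a * M)" by (simp add: a_def)
  also have "\<dots> \<le> a\<^sup>2 / q + q * M\<^sup>2" by (intro two_mult_le_weighted_squares q_bounds)
  finally have distance: "(norm (zhat (Suc k) - zs))\<^sup>2 \<le> (1 - \<tau>) * A + 2 * \<tau> * M\<^sup>2
     - 2 * \<eta> * Dg - c * (1 - \<tau>) * (Dg - Df) + (a\<^sup>2 / q + q * M\<^sup>2) + a\<^sup>2"
    using distance_recursion[of k] by (simp add: A_def M_def Dg_def Df_def a_def)
  have descent: "c * (H (zf (Suc k)) - H zs) \<le> c * Dg - 21 * (a\<^sup>2 / q)"
  proof -
    have "c * (H (zf (Suc k)) - H zs) \<le> c * (Dg - \<theta> * lmin / 2 * (norm (P (g k)))\<^sup>2)"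
      using dual_descent[of k] c_pos by (intro mult_left_mono) (auto simp: Dg_def)
    also have "\<dots> = c * Dg - c * (\<theta> * lmin / 2) * (norm (P (g k)))\<^sup>2" by (simp add: algebra_simps)
    also have "\<dots> \<le> c * Dg - 21 * \<eta>\<^sup>2 / q * (norm (P (g k)))\<^sup>2"
      by (intro diff_left_mono mult_right_mono descent_gain) simp
    finally show ?thesis by (simp add: a_def power_mult_distrib)
  qed
  have feedback: "6 * (norm (P (m (Suc k))))\<^sup>2 \<le> 6 * M\<^sup>2 - 3 * (q * M\<^sup>2) + 12 * (a\<^sup>2 / q)"
    using error_feedback_contraction[of k] by (simp add: M_def a_def algebra_simps)
  have "a\<^sup>2 \<le> a\<^sup>2 / q" using q_bounds by (simp add: le_divide_eq mult_left_le)
  moreover have "7 * (\<tau> * M\<^sup>2) \<le> q * M\<^sup>2"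
    using mult_right_mono[OF \<tau>_bounds(2), of "M\<^sup>2"] by simp
  moreover have "0 \<le> \<tau> * M\<^sup>2" using \<tau>_bounds(1) by simp
  moreover have "0 \<le> a\<^sup>2 / q" using q_bounds by simp
  moreover have "c * \<tau> * Dg - 2 * \<eta> * Dg \<le> 0"
  proof -
    have "c * \<tau> - 2 * \<eta> = - (2 * \<eta> * \<tau>)" using \<tau>_bounds(1) by (simp add: c_def field_simps)
    then have "c * \<tau> * Dg - 2 * \<eta> * Dg = - (2 * \<eta> * \<tau>) * Dg" by (metis left_diff_distrib)
    then show ?thesis
      using gap_nonneg[OF in_S(3), of k] \<eta>_pos \<tau>_bounds(1) by (simp add: Dg_def)
  qed
  moreover have "(1 - \<tau>) * lyapunov k = (1 - \<tau>) * A + (1 - \<tau>) * c * Df + 6 * M\<^sup>2 - 6 * (\<tau> * M\<^sup>2)"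
    by (simp add: lyapunov_def A_def Df_def M_def algebra_simps)
  moreover have "c * (1 - \<tau>) * (Dg - Df) = c * Dg - c * \<tau> * Dg - (1 - \<tau>) * c * Df"
    by (simp add: algebra_simps)
  ultimately show ?thesis using distance descent feedback unfolding lyapunov_def by linarith
qed

lemma lyapunov_bound: "lyapunov k \<le> (1 - \<tau>) ^ k * lyapunov 0"
proof (induction k)
  case (Suc k)
  have "lyapunov (Suc k) \<le> (1 - \<tau>) * lyapunov k" by (rule lyapunov_contraction)
  also have "\<dots> \<le> (1 - \<tau>) * ((1 - \<tau>) ^ k * lyapunov 0)"
    using Suc \<tau>_bounds by (intro mult_left_mono) auto
  finally show ?case by simp
qed simp

lemma dual_distance_le_lyapunov: "(norm (zg k - zs))\<^sup>2 \<le> (2 + 2 * L / c) * lyapunov k"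
proof -
  define Df where "Df = H (zf k) - H zs"
  have Df: "0 \<le> Df" unfolding Df_def by (intro gap_nonneg in_S)
  then have cDf: "0 \<le> c * Df" using c_pos by simp
  have z: "(norm (z k - zs))\<^sup>2 \<le> 2 * lyapunov k"
    using norm_add_squared_le[of "zhat k - zs" "- P (m k)"] cDf
    by (simp add: lyapunov_def zhat_def Df_def)
      (smt (verit) zero_le_power2)
  have "c * Df \<le> lyapunov k" unfolding lyapunov_def Df_def by simp
  then have "Df \<le> lyapunov k / c" using c_pos by (simp add: le_divide_eq mult.commute)
  then have "2 * L * Df \<le> 2 * L * (lyapunov k / c)" using L_pos by (intro mult_left_mono) auto
  moreover have "(norm (zf k - zs))\<^sup>2 \<le> 2 * L * Df"
    using quadratic_growth[OF in_S(2), of k] L_pos by (simp add: Df_def field_simps)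
  ultimately have zf: "(norm (zf k - zs))\<^sup>2 \<le> 2 * L / c * lyapunov k" by simp
  have "zg k - zs = (1 - \<tau>) *\<^sub>R (zf k - zs) + \<tau> *\<^sub>R (z k - zs)"
    unfolding step(2)[of k] by (simp add: algebra_simps)
  then have "(norm (zg k - zs))\<^sup>2 \<le> (1 - \<tau>) * (norm (zf k - zs))\<^sup>2 + \<tau> * (norm (z k - zs))\<^sup>2"
    using \<tau>_bounds by (simp add: norm_convex_combination_squared_le)
  also have "\<dots> \<le> 1 * (norm (zf k - zs))\<^sup>2 + 1 * (norm (z k - zs))\<^sup>2"
    using \<tau>_bounds by (intro add_mono mult_right_mono) auto
  finally show ?thesis using z zf by (simp add: algebra_simps)
qed

lemma dual_iterates_converge_linearly:
  "\<exists>C. \<forall>k. (norm (zg k - zs))\<^sup>2 \<le> C * (1 - \<tau>) ^ k"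
proof (intro exI allI)
  fix k
  have "(norm (zg k - zs))\<^sup>2 \<le> (2 + 2 * L / c) * lyapunov k" by (rule dual_distance_le_lyapunov)
  also have "\<dots> \<le> (2 + 2 * L / c) * ((1 - \<tau>) ^ k * lyapunov 0)"
    using L_pos c_pos by (intro mult_left_mono lyapunov_bound) auto
  finally show "(norm (zg k - zs))\<^sup>2 \<le> (2 + 2 * L / c) * lyapunov 0 * (1 - \<tau>) ^ k"
    by (simp add: algebra_simps)
qed

end

section \<open>ADOM over a time-varying network\<close>

text \<open>The Lagrange condition of the constrained problem: the gradient at the minimizer is the dual
  solution, and it lies in the subspace containing the dual iterates.\<close>

lemma grad_minimizer_orthogonal_subspace:
  assumes f: "smooth_strongly_convex L \<mu> f" and K: "subspace K"
    and min: "is_arg_min f (\<lambda>x. x \<in> K) x"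
  shows "grad f x \<in> K\<^sup>\<bottom>"
proof -
  have "grad f x \<bullet> h = 0" if h: "h \<in> K" for h
  proof (rule first_order_optimality[OF f])
    fix t
    have "x + t *\<^sub>R h \<in> K" using min h K by (simp add: is_arg_min_def subspace_add subspace_scale)
    then show "f x \<le> f (x + t *\<^sub>R h) - t * 0" using min by (simp add: is_arg_min_linorder)
  qed
  then show ?thesis by (simp add: orthogonal_comp_def orthogonal_def inner_commute)
qed

theorem theorem1:
  fixes f :: "'n::finite \<Rightarrow> real ^ 'd::finite \<Rightarrow> real"
    and F :: "real ^ 'd ^ 'n \<Rightarrow> real"
    and L \<mu> lmin lmax \<alpha> \<eta> \<theta> \<sigma> \<tau> :: real
    and E :: "nat \<Rightarrow> ('n \<times> 'n) set"
    and What :: "nat \<Rightarrow> real ^ 'n ^ 'n"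
    and xstar :: "real ^ 'd ^ 'n"
    and z m zf zg \<Delta> :: "nat \<Rightarrow> real ^ 'd ^ 'n"
  assumes "0 < \<mu>" and "\<mu> \<le> L"
    and "\<And>i. smooth_strongly_convex L \<mu> (f i)"
    and "F = separable_sum f"
    and "is_arg_min F (\<lambda>x. x \<in> consensus) xstar"
    and "0 < lmin" and "lmin < lmax"
    and "\<And>k. undirected_connected (E k)"
    and "\<And>k. gossip_matrix (E k) (What k)"
    and "\<And>k. spectral_bounds lmin lmax (What k)"
    and "\<alpha> = 1 / (2 * L)"
    and "\<eta> = 2 * lmin * sqrt (\<mu> * L) / (7 * lmax)"
    and "\<theta> = \<mu> / lmax"
    and "\<sigma> = 1 / lmax"
    and "\<tau> = lmin / (7 * lmax) * sqrt (\<mu> / L)"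
    and "z 0 \<in> consensus\<^sup>\<bottom>"
    and "adom_iteration (grad (fenchel_conjugate F)) (\<lambda>k. block_action (What k))
           \<alpha> \<eta> \<theta> \<sigma> \<tau> z m zf zg \<Delta>"
  shows "\<exists>C>0. \<forall>k. (norm (grad (fenchel_conjugate F) (zg k) - xstar))\<^sup>2
           \<le> C * (1 - lmin / (7 * lmax) * sqrt (\<mu> / L)) ^ k"
proof -
  note gossip = \<open>gossip_matrix (E _) (What _)\<close> and bounds = \<open>spectral_bounds lmin lmax (What _)\<close>
  define H where "H = fenchel_conjugate F"
  define zs where "zs = grad F xstar"
  have L: "0 < L" using assms(1,2) by simp
  have F: "smooth_strongly_convex L \<mu> F"
    unfolding \<open>F = separable_sum f\<close>
    using smooth_strongly_convex_separable_sum[OF assms(3)] assms(1) L by simp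
  have H: "smooth_strongly_convex (1 / \<mu>) (1 / L) H" and inverse: "grad H (grad F x) = x" for x
    unfolding H_def using smooth_strongly_convex_conjugate[OF F assms(1) L] by auto
  (* The dual solution zs has primal point xstar; since xstar is a consensus vector, the gradient
     of H at zs is orthogonal to the zero-sum vectors. *)
  have xstar: "grad H zs = xstar" by (simp add: zs_def inverse)
  interpret adom "consensus\<^sup>\<bottom>" centered "\<lambda>k. block_action (What k)" H zs
    L \<mu> lmin lmax \<alpha> \<eta> \<theta> \<sigma> \<tau> z m zf zg \<Delta>
  proof (rule adom.intro)
    show "subspace ((consensus :: (real ^ 'd ^ 'n) set)\<^sup>\<bottom>)" by (rule subspace_orthogonal_comp)
    show "linear (centered :: real ^ 'd ^ 'n \<Rightarrow> _)" by (rule linear_centered)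
    show "zs \<in> consensus\<^sup>\<bottom>"
      unfolding zs_def by (rule grad_minimizer_orthogonal_subspace[OF F subspace_consensus assms(5)])
    fix k and x s :: "real ^ 'd ^ 'n"
    show "centered x \<in> consensus\<^sup>\<bottom>" by (rule centered_in_consensus_comp)
    show "s \<bullet> centered x = s \<bullet> x" if "s \<in> consensus\<^sup>\<bottom>"
    proof -
      have "s \<bullet> (x - centered x) = 0"
        using that diff_centered_in_consensus[of x]
        by (auto simp: orthogonal_comp_def orthogonal_def inner_commute)
      then show ?thesis by (simp add: inner_diff_right)
    qed
    show "block_action (What k) x \<in> consensus\<^sup>\<bottom>" by (rule block_action_in_consensus_comp[OF gossip])
    show "block_action (What k) (centered x) = block_action (What k) x"
      using block_action_consensus[OF gossip diff_centered_in_consensus, of k x]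
      by (simp add: linear_diff[OF linear_block_action])
    show "(norm (block_action (What k) x))\<^sup>2 \<le> lmax * (x \<bullet> block_action (What k) x)"
      using assms(6,7) by (intro block_action_norm_le[OF gossip bounds]) simp
    show "lmin * (norm x)\<^sup>2 \<le> x \<bullet> block_action (What k) x" if "x \<in> consensus\<^sup>\<bottom>"
      using that by (rule block_action_coercive[OF gossip bounds])
    show "grad H zs \<bullet> s = 0" if "s \<in> consensus\<^sup>\<bottom>"
      using that assms(5) by (simp add: xstar is_arg_min_def orthogonal_comp_def orthogonal_def)
  qed (use assms H in \<open>simp_all add: H_def\<close>)
  obtain C where C: "\<And>k. (norm (zg k - zs))\<^sup>2 \<le> C * (1 - \<tau>) ^ k"
    using dual_iterates_converge_linearly by blast
  have rate: "0 \<le> 1 - \<tau>" using \<tau>_bounds by simp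
  show ?thesis
  proof (intro exI conjI allI)
    (* Absolute value and 1 only make the constant positive. *)
    show "0 < \<bar>C\<bar> / \<mu>\<^sup>2 + 1" by (simp add: add_nonneg_pos)
    fix k
    obtain x where x: "zg k = grad F x" using grad_surjective[OF F assms(1)] by metis
    (* The gradient of F expands distances by at least \<mu>, so its inverse is Lipschitz. *)
    have "\<mu> * norm (grad H (zg k) - xstar) \<le> norm (zg k - zs)"
      using grad_expansive[OF F, of x xstar] by (simp add: x inverse zs_def)
    then have "(\<mu> * norm (grad H (zg k) - xstar))\<^sup>2 \<le> (norm (zg k - zs))\<^sup>2"
      using assms(1) by (intro power_mono) auto
    also have "\<dots> \<le> C * (1 - \<tau>) ^ k" by (rule C)
    finally have "(norm (grad H (zg k) - xstar))\<^sup>2 \<le> C / \<mu>\<^sup>2 * (1 - \<tau>) ^ k"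
      using assms(1) by (simp add: power_mult_distrib field_simps)
    also have "\<dots> \<le> (\<bar>C\<bar> / \<mu>\<^sup>2 + 1) * (1 - \<tau>) ^ k"
    proof (rule mult_right_mono)
      have "C / \<mu>\<^sup>2 \<le> \<bar>C\<bar> / \<mu>\<^sup>2" by (intro divide_right_mono) auto
      then show "C / \<mu>\<^sup>2 \<le> \<bar>C\<bar> / \<mu>\<^sup>2 + 1" by simp
    qed (use rate in simp)
    finally show "(norm (grad (fenchel_conjugate F) (zg k) - xstar))\<^sup>2
        \<le> (\<bar>C\<bar> / \<mu>\<^sup>2 + 1) * (1 - lmin / (7 * lmax) * sqrt (\<mu> / L)) ^ k"
      by (simp add: H_def \<tau>)
  qed
qed

end
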